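(* Let $\Omega\subset\mathbb{R}^n$ be an open convex set. Then the automorphism group $\operatorname{Aut}(C_0(\Omega))$ and the isometry group $\operatorname{Iso}(C_0(\Omega))$ of $C_0(\Omega)$ are algebraically reflexive.
   Context: $C_0(\Omega)$ is the $C^*$-algebra of all continuous complex valued functions on $\Omega$ vanishing at infinity (with respect to the locally compact space $\Omega$), with sup norm. For a Banach algebra $\mathcal{A}$, $\operatorname{Aut}(\mathcal{A})$ is the group of automorphisms of $\mathcal{A}$, i.e. multiplicative linear bijections $\mathcal{A}\to\mathcal{A}$, and $\operatorname{Iso}(\mathcal{A})$ is the group of surjective linear isometries $\mathcal{A}\to\mathcal{A}$. For a Banach space $\mathscr{X}$, with $\mathscr{B}(\mathscr{X})$ the algebra of bounded linear operators on $\mathscr{X}$, and a subset $\mathscr{E}\subset\mathscr{B}(\mathscr{X})$, let $\operatorname{ref}_{al}\mathscr{E}=\{T\in\mathscr{B}(\mathscr{X}): \text{for every } x\in\mathscr{X} \text{ there is } E\in\mathscr{E} \text{ with } Tx=Ex\}$; $\mathscr{E}$ is called algebraically reflexive if $\operatorname{ref}_{al}\mathscr{E}=\mathscr{E}$. *)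

theory Defs
  imports "HOL-Analysis.Analysis"
begin

section \<open>The algebra of continuous functions vanishing at infinity\<close>

text \<open>
  A function on \<open>\<Omega>\<close> is represented by its extension by \<open>0\<close> to the whole ambient type, so that
  equality of representatives is equality on \<open>\<Omega>\<close> and the pointwise operations need no restriction.
  The point at infinity is that of the locally compact space \<open>\<Omega>\<close>: the compact sets \<open>K\<close> are subsets
  of \<open>\<Omega>\<close>, so the functions also tend to \<open>0\<close> at the finite boundary points of \<open>\<Omega>\<close>.
\<close>

definition C0 :: "'a::topological_space set \<Rightarrow> ('a \<Rightarrow> complex) set" where
  "C0 \<Omega> = {f. continuous_on \<Omega> f \<and>
              (\<forall>e>0. \<exists>K. compact K \<and> K \<subseteq> \<Omega> \<and> (\<forall>x\<in>\<Omega> - K. cmod (f x) < e)) \<and>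
              (\<forall>x. x \<notin> \<Omega> \<longrightarrow> f x = 0)}"

text \<open>The inserted \<open>0\<close> only matters for \<open>\<Omega> = {}\<close>, where the only function has norm \<open>0\<close>.\<close>

definition supnorm :: "'a set \<Rightarrow> ('a \<Rightarrow> complex) \<Rightarrow> real" where
  "supnorm \<Omega> f = Sup (insert 0 ((\<lambda>x. cmod (f x)) ` \<Omega>))"

section \<open>Operators on a space of complex functions\<close>

text \<open>
  Below, \<open>V\<close> is a set of complex functions, regarded as a complex vector space (or algebra) under the
  pointwise operations, and \<open>N\<close> is its norm. Operators are extensional functions on \<open>V\<close>, so that
  equality of operators is equality on \<open>V\<close>.
\<close>

definition linear_ops :: "('a \<Rightarrow> complex) set \<Rightarrow> (('a \<Rightarrow> complex) \<Rightarrow> ('a \<Rightarrow> complex)) set" where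
  "linear_ops V = {T \<in> V \<rightarrow>\<^sub>E V.
     (\<forall>f\<in>V. \<forall>g\<in>V. T (\<lambda>x. f x + g x) = (\<lambda>x. T f x + T g x)) \<and>
     (\<forall>c. \<forall>f\<in>V. T (\<lambda>x. c * f x) = (\<lambda>x. c * T f x))}"

definition bounded_ops ::
    "('a \<Rightarrow> complex) set \<Rightarrow> (('a \<Rightarrow> complex) \<Rightarrow> real) \<Rightarrow> (('a \<Rightarrow> complex) \<Rightarrow> ('a \<Rightarrow> complex)) set" where
  "bounded_ops V N = {T \<in> linear_ops V. \<exists>K. \<forall>f\<in>V. N (T f) \<le> K * N f}"

definition Aut :: "('a \<Rightarrow> complex) set \<Rightarrow> (('a \<Rightarrow> complex) \<Rightarrow> ('a \<Rightarrow> complex)) set" where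
  "Aut V = {T \<in> linear_ops V. bij_betw T V V \<and>
     (\<forall>f\<in>V. \<forall>g\<in>V. T (\<lambda>x. f x * g x) = (\<lambda>x. T f x * T g x))}"

definition Iso ::
    "('a \<Rightarrow> complex) set \<Rightarrow> (('a \<Rightarrow> complex) \<Rightarrow> real) \<Rightarrow> (('a \<Rightarrow> complex) \<Rightarrow> ('a \<Rightarrow> complex)) set" where
  "Iso V N = {T \<in> linear_ops V. T ` V = V \<and> (\<forall>f\<in>V. N (T f) = N f)}"

definition ref_al ::
    "('a \<Rightarrow> complex) set \<Rightarrow> (('a \<Rightarrow> complex) \<Rightarrow> real) \<Rightarrow> (('a \<Rightarrow> complex) \<Rightarrow> ('a \<Rightarrow> complex)) set
      \<Rightarrow> (('a \<Rightarrow> complex) \<Rightarrow> ('a \<Rightarrow> complex)) set" where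
  "ref_al V N E = {T \<in> bounded_ops V N. \<forall>f\<in>V. \<exists>S\<in>E. T f = S f}"

definition algebraically_reflexive ::
    "('a \<Rightarrow> complex) set \<Rightarrow> (('a \<Rightarrow> complex) \<Rightarrow> real) \<Rightarrow> (('a \<Rightarrow> complex) \<Rightarrow> ('a \<Rightarrow> complex)) set \<Rightarrow> bool"
  where "algebraically_reflexive V N E \<longleftrightarrow> ref_al V N E = E"

end

theory Submission
  imports Defs
begin

text \<open>
  An isometry \<open>T\<close> of \<open>C\<^sub>0(\<Omega>)\<close> moves point evaluations backwards (Holsztynski): for every \<open>y\<close> the sets
  where \<open>\<bar>T f\<bar>\<close> attains the norm, for the functions \<open>f\<close> that attain theirs at \<open>y\<close>, have a common point
  \<open>x\<close>, and \<open>\<bar>T f x\<bar> = \<bar>f y\<bar>\<close> for all \<open>f\<close>. If \<open>T\<close> agrees at each function with some surjective isometry, then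
  \<open>T\<close> sends a function with a strict peak to one with a unique peak, and a nowhere zero function to a
  nowhere zero one. The former makes \<open>x = \<psi> y\<close> unique and \<open>\<psi>\<close> continuous and injective, so its image is
  open by invariance of domain; the latter makes the image closed in \<open>\<Omega>\<close>. By connectedness \<open>\<psi>\<close> is a
  homeomorphism of \<open>\<Omega>\<close>, and \<open>T\<close> is a weighted composition operator with unimodular weight.

  Automorphisms preserve the nonzero values of a function, because these are detected by the
  absence of a quasi-inverse. Hence they are isometries, and a local automorphism is a weighted
  composition operator whose weight is nonnegative, thus \<open>1\<close>.
\<close>

section \<open>Functions vanishing at infinity\<close>

lemma C0_continuous: "f \<in> C0 \<Omega> \<Longrightarrow> continuous_on \<Omega> f"
  and C0_outside: "f \<in> C0 \<Omega> \<Longrightarrow> x \<notin> \<Omega> \<Longrightarrow> f x = 0"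
  by (auto simp: C0_def)

lemma C0_eqI:
  assumes "f \<in> C0 \<Omega>" "g \<in> C0 \<Omega>" "\<And>x. x \<in> \<Omega> \<Longrightarrow> f x = g x"
  shows "f = g"
proof
  fix x show "f x = g x" using assms by (cases "x \<in> \<Omega>") (auto simp: C0_outside)
qed

text \<open>The set is relatively closed in a compact \<open>K\<close> supplied by the definition,
  outside which \<open>f\<close> is smaller than \<open>e\<close>.\<close>

lemma C0_compact_level:
  fixes \<Omega> :: "'a::t2_space set"
  assumes "f \<in> C0 \<Omega>" "0 < e"
  shows "compact {x\<in>\<Omega>. e \<le> cmod (f x)}"
proof -
  obtain K where K: "compact K" "K \<subseteq> \<Omega>" "\<forall>x\<in>\<Omega> - K. cmod (f x) < e"
    using assms by (auto simp: C0_def)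
  have "continuous_on K (\<lambda>x. cmod (f x))"
    using C0_continuous[OF assms(1)] K(2) by (intro continuous_on_norm) (rule continuous_on_subset)
  then have "compact (K \<inter> (\<lambda>x. cmod (f x)) -` {e..})"
    using K(1) by (intro closedin_compact[OF K(1)] continuous_closedin_preimage) auto
  also have "K \<inter> (\<lambda>x. cmod (f x)) -` {e..} = {x\<in>\<Omega>. e \<le> cmod (f x)}"
    using K by (auto simp: not_less[symmetric])
  finally show ?thesis .
qed

lemma C0I:
  assumes "continuous_on \<Omega> f" "\<And>e. 0 < e \<Longrightarrow> compact {x\<in>\<Omega>. e \<le> cmod (f x)}"
    and "\<And>x. x \<notin> \<Omega> \<Longrightarrow> f x = 0"
  shows "f \<in> C0 \<Omega>"
  unfolding C0_def
proof (intro CollectI conjI allI impI)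
  fix e :: real assume "0 < e"
  then show "\<exists>K. compact K \<and> K \<subseteq> \<Omega> \<and> (\<forall>x\<in>\<Omega> - K. cmod (f x) < e)"
    using assms(2) by (intro exI[of _ "{x\<in>\<Omega>. e \<le> cmod (f x)}"]) auto
qed (use assms in auto)

text \<open>A compact set that works for \<open>f\<close> and \<open>d\<close> works for
  \<open>g\<close> and \<open>e\<close>.\<close>

lemma C0_dominated:
  assumes "f \<in> C0 \<Omega>" "continuous_on \<Omega> g" "\<And>x. x \<notin> \<Omega> \<Longrightarrow> g x = 0"
    and "\<And>e. 0 < e \<Longrightarrow> \<exists>d>0. \<forall>x\<in>\<Omega>. cmod (f x) < d \<longrightarrow> cmod (g x) < e"
  shows "g \<in> C0 \<Omega>"
  unfolding C0_def
proof (intro CollectI conjI allI impI)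
  fix e :: real assume "0 < e"
  then obtain d where d: "d > 0" "\<forall>x\<in>\<Omega>. cmod (f x) < d \<longrightarrow> cmod (g x) < e"
    using assms(4) by blast
  then obtain K where "compact K" "K \<subseteq> \<Omega>" "\<forall>x\<in>\<Omega> - K. cmod (f x) < d"
    using assms(1) by (auto simp: C0_def)
  then show "\<exists>K. compact K \<and> K \<subseteq> \<Omega> \<and> (\<forall>x\<in>\<Omega> - K. cmod (g x) < e)"
    using d by blast
qed (use assms in auto)

lemma C0_mult_bounded:
  assumes "f \<in> C0 \<Omega>" "continuous_on \<Omega> g" "\<And>x. x \<in> \<Omega> \<Longrightarrow> cmod (g x) \<le> B"
  shows "(\<lambda>x. f x * g x) \<in> C0 \<Omega>"
proof (rule C0_dominated[OF assms(1)])
  show "continuous_on \<Omega> (\<lambda>x. f x * g x)"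
    by (intro continuous_intros assms C0_continuous)
  fix e :: real assume e: "0 < e"
  show "\<exists>d>0. \<forall>x\<in>\<Omega>. cmod (f x) < d \<longrightarrow> cmod (f x * g x) < e"
  proof (intro exI[of _ "e / (\<bar>B\<bar> + 1)"] conjI ballI impI)
    fix x assume x: "x \<in> \<Omega>" "cmod (f x) < e / (\<bar>B\<bar> + 1)"
    have "cmod (f x * g x) \<le> cmod (f x) * (\<bar>B\<bar> + 1)"
      unfolding norm_mult using assms(3)[OF x(1)] by (intro mult_left_mono) auto
    also have "\<dots> < e" using x(2) by (simp add: field_simps)
    finally show "cmod (f x * g x) < e" .
  qed (use e in auto)
qed (use C0_outside[OF assms(1)] in auto)

lemma C0_scale: "f \<in> C0 \<Omega> \<Longrightarrow> (\<lambda>x. c * f x) \<in> C0 \<Omega>"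
  using C0_mult_bounded[of f \<Omega> "\<lambda>_. c" "cmod c"] by (simp add: mult.commute)

lemma C0_add:
  fixes \<Omega> :: "'a::t2_space set"
  assumes "f \<in> C0 \<Omega>" "g \<in> C0 \<Omega>"
  shows "(\<lambda>x. f x + g x) \<in> C0 \<Omega>"
  unfolding C0_def
proof (intro CollectI conjI allI impI)
  show "continuous_on \<Omega> (\<lambda>x. f x + g x)"
    by (intro continuous_intros assms C0_continuous)
  fix e :: real assume e: "0 < e"
  define K where "K f = {x\<in>\<Omega>. e/2 \<le> cmod (f x)}" for f :: "'a \<Rightarrow> complex"
  show "\<exists>K. compact K \<and> K \<subseteq> \<Omega> \<and> (\<forall>x\<in>\<Omega> - K. cmod (f x + g x) < e)"
  proof (intro exI[of _ "K f \<union> K g"] conjI ballI)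
    show "compact (K f \<union> K g)"
      unfolding K_def using assms e by (intro compact_Un C0_compact_level) auto
    fix x assume "x \<in> \<Omega> - (K f \<union> K g)"
    then show "cmod (f x + g x) < e"
      using norm_triangle_ineq[of "f x" "g x"] by (auto simp: K_def)
  qed (auto simp: K_def)
qed (use assms in \<open>auto simp: C0_outside\<close>)

text \<open>Compactness bounds \<open>f\<close> on its level set at height 1; elsewhere 1 is a
  bound.\<close>

lemma C0_bounded:
  fixes \<Omega> :: "'a::t2_space set"
  assumes "f \<in> C0 \<Omega>"
  obtains B where "0 \<le> B" "\<And>x. cmod (f x) \<le> B"
proof -
  define K where "K = {x\<in>\<Omega>. 1 \<le> cmod (f x)}"
  have "compact (f ` K)" unfolding K_def
    by (intro compact_continuous_image C0_compact_level assms
        continuous_on_subset[OF C0_continuous[OF assms]]) auto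
  then obtain B where B: "0 < B" "\<And>x. x \<in> K \<Longrightarrow> cmod (f x) \<le> B"
    using bounded_pos[of "f ` K"] compact_imp_bounded by auto
  have "cmod (f x) \<le> max B 1" for x
    using B(2)[of x] C0_outside[OF assms, of x] by (cases "x \<in> K"; cases "x \<in> \<Omega>") (auto simp: K_def)
  then show ?thesis using that[of "max B 1"] by auto
qed

lemma C0_mult:
  fixes \<Omega> :: "'a::t2_space set"
  assumes "f \<in> C0 \<Omega>" "g \<in> C0 \<Omega>"
  shows "(\<lambda>x. f x * g x) \<in> C0 \<Omega>"
  using C0_bounded[OF assms(2)] C0_mult_bounded[OF assms(1) C0_continuous[OF assms(2)]] by metis

section \<open>The supremum norm and strictly peaking functions\<close>

lemma cmod_le_supnorm:
  fixes \<Omega> :: "'a::t2_space set"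
  assumes "f \<in> C0 \<Omega>"
  shows "cmod (f x) \<le> supnorm \<Omega> f"
proof -
  obtain B where B: "0 \<le> B" "\<And>x. cmod (f x) \<le> B" using C0_bounded[OF assms] by blast
  then have "bdd_above (insert 0 ((\<lambda>x. cmod (f x)) ` \<Omega>))" by (auto simp: bdd_above_def)
  moreover have "cmod (f x) \<in> insert 0 ((\<lambda>x. cmod (f x)) ` \<Omega>)"
    using C0_outside[OF assms, of x] by (cases "x \<in> \<Omega>") auto
  ultimately show ?thesis unfolding supnorm_def by (rule cSup_upper[rotated])
qed

lemma supnorm_le:
  assumes "0 \<le> B" "\<And>x. x \<in> \<Omega> \<Longrightarrow> cmod (f x) \<le> B"
  shows "supnorm \<Omega> f \<le> B"
  unfolding supnorm_def using assms by (intro cSup_least) auto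

text \<open>A positive supremum is not approached outside the level set at half its height, and on
  that compact set the modulus has a maximum.\<close>

lemma supnorm_attained:
  fixes \<Omega> :: "'a::t2_space set"
  assumes f: "f \<in> C0 \<Omega>" and pos: "0 < supnorm \<Omega> f"
  obtains x where "x \<in> \<Omega>" "cmod (f x) = supnorm \<Omega> f"
proof -
  define s where "s = supnorm \<Omega> f"
  define K where "K = {x\<in>\<Omega>. s/2 \<le> cmod (f x)}"
  have small: "cmod (f x) \<le> s/2" if "x \<in> \<Omega> - K" for x
    using that by (auto simp: K_def)
  have "compact K" unfolding K_def using f pos by (intro C0_compact_level) (auto simp: s_def)
  moreover have "K \<noteq> {}"
    using supnorm_le[of "s/2" \<Omega> f] small pos by (force simp: s_def)
  moreover have "continuous_on K (\<lambda>x. cmod (f x))"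
    by (intro continuous_on_norm continuous_on_subset[OF C0_continuous[OF f]]) (auto simp: K_def)
  ultimately obtain x where x: "x \<in> K" "\<And>z. z \<in> K \<Longrightarrow> cmod (f z) \<le> cmod (f x)"
    using continuous_attains_sup by metis
  have "s \<le> cmod (f x)" unfolding s_def
  proof (rule supnorm_le)
    fix z assume "z \<in> \<Omega>"
    then show "cmod (f z) \<le> cmod (f x)" using x small[of z] by (cases "z \<in> K") (auto simp: K_def)
  qed auto
  with cmod_le_supnorm[OF f, of x] x(1) that[of x] show ?thesis by (auto simp: s_def K_def)
qed

lemma supnorm_eqI:
  fixes \<Omega> :: "'a::t2_space set"
  assumes "f \<in> C0 \<Omega>" "\<And>x. x \<in> \<Omega> \<Longrightarrow> cmod (f x) \<le> cmod (f y)"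
  shows "supnorm \<Omega> f = cmod (f y)"
  using supnorm_le[of "cmod (f y)" \<Omega> f] cmod_le_supnorm[OF assms(1), of y] assms(2) by force

text \<open>A product of two factors: the truncated distance to the complement, positive exactly on
  \<Omega>, gives decay at the boundary, and \<open>1 / (1 + dist x y)\<close> gives decay at
  infinity and the strict maximum at \<open>y\<close>.\<close>

lemma C0_peak_function:
  fixes \<Omega> :: "'a::euclidean_space set"
  assumes "open \<Omega>" "y \<in> \<Omega>"
  obtains p :: "'a \<Rightarrow> real" where "(\<lambda>x. complex_of_real (p x)) \<in> C0 \<Omega>" "p y = 1"
    "\<And>x. x \<in> \<Omega> \<Longrightarrow> 0 < p x" "\<And>x. x \<noteq> y \<Longrightarrow> p x < 1"
proof -
  \<comment> \<open>The whole space is a separate case because \<open>infdist\<close> to the empty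
    set is \<open>0\<close>.\<close>
  define k where "k x = (if \<Omega> = UNIV then 1 else min 1 (infdist x (- \<Omega>) / infdist y (- \<Omega>)))" for x
  define p where "p x = k x / (1 + dist x y)" for x
  have pos: "infdist x (- \<Omega>) > 0" if "x \<in> \<Omega>" "\<Omega> \<noteq> UNIV" for x
    using that assms(1) infdist_pos_not_in_closed[of "-\<Omega>" x] by auto
  have k0: "0 \<le> k x" "k x \<le> 1" for x by (auto simp: k_def infdist_nonneg)
  have kpos: "0 < k x \<longleftrightarrow> x \<in> \<Omega>" for x
    using pos[of x] pos[OF assms(2)] by (cases "x \<in> \<Omega>"; cases "\<Omega> = UNIV") (auto simp: k_def)
  have "k y = 1" using pos[OF assms(2)] by (cases "\<Omega> = UNIV") (auto simp: k_def)
  then have py: "p y = 1" by (simp add: p_def)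
  have cont: "continuous_on UNIV p"
  proof -
    have "continuous_on UNIV k"
      unfolding k_def by (cases "\<Omega> = UNIV") (use pos[OF assms(2)] in \<open>auto intro!: continuous_intros\<close>)
    then show ?thesis unfolding p_def
      by (intro continuous_intros) (auto simp: add_nonneg_eq_0_iff add_nonneg_pos)
  qed
  have p0: "0 \<le> p x" for x using k0[of x] by (simp add: p_def)
  have ppos: "0 < p x" if "x \<in> \<Omega>" for x
    using kpos[of x] that unfolding p_def by (intro divide_pos_pos add_pos_nonneg) auto
  have pout: "p x = 0" if "x \<notin> \<Omega>" for x
    using kpos[of x] k0(1)[of x] that by (simp add: p_def)
  have ple: "p x \<le> 1 / (1 + dist x y)" for x
    unfolding p_def using k0(2)[of x] by (intro divide_right_mono) auto
  have "(\<lambda>x. complex_of_real (p x)) \<in> C0 \<Omega>"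
  proof (rule C0I)
    show "continuous_on \<Omega> (\<lambda>x. complex_of_real (p x))"
      using cont continuous_on_subset by (intro continuous_intros) blast
    fix e :: real assume e: "0 < e"
    \<comment> \<open>As \<open>p\<close> is continuous on the whole space and vanishes off
      \<Omega>, its level sets are closed in the whole space and not merely in \<Omega>.\<close>
    have eq: "{x\<in>\<Omega>. e \<le> cmod (complex_of_real (p x))} = p -` {e..}"
      using p0 e pout by (auto simp: vimage_def) (metis not_le)
    have "closed (p -` {e..})" using cont by (simp add: continuous_on_closed_vimage)
    moreover have "p -` {e..} \<subseteq> cball y (1/e)"
    proof
      fix x assume "x \<in> p -` {e..}"
      then have "e \<le> 1 / (1 + dist x y)" using ple[of x] by simp
      then have "e * (1 + dist x y) \<le> 1" by (simp add: field_simps add_pos_nonneg)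
      then have "e * dist x y \<le> 1" using e by (simp add: algebra_simps)
      then show "x \<in> cball y (1/e)" using e by (simp add: field_simps dist_commute)
    qed
    ultimately show "compact {x\<in>\<Omega>. e \<le> cmod (complex_of_real (p x))}"
      unfolding eq using bounded_cball bounded_subset compact_eq_bounded_closed by blast
  qed (use pout in auto)
  moreover have "p x < 1" if "x \<noteq> y" for x
    by (rule le_less_trans[OF ple]) (use that in \<open>simp add: field_simps add_pos_nonneg\<close>)
  ultimately show ?thesis using that[of p] py ppos by blast
qed

section \<open>Linear isometries\<close>

lemma linear_ops_closed: "T \<in> linear_ops V \<Longrightarrow> f \<in> V \<Longrightarrow> T f \<in> V"
  and linear_ops_add: "T \<in> linear_ops V \<Longrightarrow> f \<in> V \<Longrightarrow> g \<in> V \<Longrightarrow> T (\<lambda>x. f x + g x) = (\<lambda>x. T f x + T g x)"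
  and linear_ops_scale: "T \<in> linear_ops V \<Longrightarrow> f \<in> V \<Longrightarrow> T (\<lambda>x. c * f x) = (\<lambda>x. c * T f x)"
  by (auto simp: linear_ops_def)

text \<open>The restriction makes the inverse extensional, as membership in
  \<open>linear_ops\<close> demands.\<close>

lemma inverse_linear_ops:
  assumes T: "T \<in> linear_ops V" "bij_betw T V V"
    and add: "\<And>f g. f \<in> V \<Longrightarrow> g \<in> V \<Longrightarrow> (\<lambda>x. f x + g x) \<in> V"
    and scale: "\<And>c f. f \<in> V \<Longrightarrow> (\<lambda>x. c * f x) \<in> V"
  shows "restrict (inv_into V T) V \<in> linear_ops V"
proof -
  have inv: "inv_into V T g \<in> V" "T (inv_into V T g) = g" if "g \<in> V" for g
    using T(2) that by (auto simp: bij_betw_def inv_into_into f_inv_into_f)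
  have eq: "inv_into V T g = f" if "f \<in> V" "T f = g" for f g
    using T(2) that by (auto simp: bij_betw_def)
  show ?thesis
    unfolding linear_ops_def
  proof (intro CollectI conjI ballI allI)
    fix f g assume "f \<in> V" "g \<in> V"
    then show "restrict (inv_into V T) V (\<lambda>x. f x + g x) =
        (\<lambda>x. restrict (inv_into V T) V f x + restrict (inv_into V T) V g x)"
      using inv add by (simp add: eq linear_ops_add[OF T(1)])
  next
    fix c f assume "f \<in> V"
    then show "restrict (inv_into V T) V (\<lambda>x. c * f x) =
        (\<lambda>x. c * restrict (inv_into V T) V f x)"
      using inv scale by (simp add: eq linear_ops_scale[OF T(1)])
  qed (use inv in auto)
qed

text \<open>The peak sets \<open>P f\<close>, for \<open>f\<close> peaking at \<open>y\<close>, are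
  compact, non-empty and directed downwards, so they share a point \<open>x\<close>. The functional
  sending \<open>f\<close> to \<open>T f x\<close> then kills every function vanishing at
  \<open>y\<close>, which makes it a unimodular multiple of evaluation at \<open>y\<close>.\<close>

lemma isometry_evaluation:
  fixes \<Omega> :: "'a::euclidean_space set"
  assumes "open \<Omega>" "y \<in> \<Omega>" and T: "T \<in> linear_ops (C0 \<Omega>)"
    and iso: "\<And>f. f \<in> C0 \<Omega> \<Longrightarrow> supnorm \<Omega> (T f) = supnorm \<Omega> f"
  shows "\<exists>x\<in>\<Omega>. \<forall>f\<in>C0 \<Omega>. cmod (T f x) = cmod (f y)"
proof -
  \<comment> \<open>Fixing the value \<open>1\<close> at \<open>y\<close>, and not only its modulus,
    keeps \<open>F\<close> closed under averages.\<close>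
  define F where "F = {f\<in>C0 \<Omega>. f y = 1 \<and> (\<forall>z. cmod (f z) \<le> 1)}"
  define P where "P f = {x\<in>\<Omega>. 1 \<le> cmod (T f x)}" for f
  have le1: "cmod (T f x) \<le> 1" if "f \<in> C0 \<Omega>" "\<And>z. cmod (f z) \<le> 1" for f x
    using cmod_le_supnorm[OF linear_ops_closed[OF T that(1)], of x] iso[OF that(1)]
      supnorm_le[of 1 \<Omega> f] that(2) by simp
  have P_compact: "compact (P f)" if "f \<in> F" for f
    unfolding P_def using that by (intro C0_compact_level linear_ops_closed[OF T]) (auto simp: F_def)
  have P_nonempty: "P f \<noteq> {}" if "f \<in> F" for f
  proof -
    have f: "f \<in> C0 \<Omega>" "f y = 1" "\<And>z. cmod (f z) \<le> 1" using that by (auto simp: F_def)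
    then have "supnorm \<Omega> (T f) = 1" using supnorm_eqI[of f \<Omega> y] iso[OF f(1)] by simp
    then obtain x where "x \<in> \<Omega>" "cmod (T f x) = 1"
      using supnorm_attained[OF linear_ops_closed[OF T f(1)]] by (metis zero_less_one)
    then show ?thesis by (auto simp: P_def)
  qed
  have avg: "\<exists>h\<in>F. P h \<subseteq> P f \<inter> P g" if fg: "f \<in> F" "g \<in> F" for f g
  proof -
    define h where "h = (\<lambda>x. (1/2) * f x + (1/2) * g x)"
    have C: "f \<in> C0 \<Omega>" "g \<in> C0 \<Omega>" using fg by (auto simp: F_def)
    have hF: "h \<in> F"
    proof -
      have "cmod (h z) \<le> 1" for z
      proof -
        have "cmod (h z) \<le> cmod ((1/2) * f z) + cmod ((1/2) * g z)"
          unfolding h_def by (rule norm_triangle_ineq)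
        also have "\<dots> = (cmod (f z) + cmod (g z)) / 2" by (simp add: norm_mult)
        also have "\<dots> \<le> 1" using fg add_mono[of "cmod (f z)" 1 "cmod (g z)" 1] by (simp add: F_def)
        finally show ?thesis .
      qed
      moreover have "h \<in> C0 \<Omega>" unfolding h_def using C by (intro C0_add C0_scale)
      ultimately show ?thesis using fg by (auto simp: F_def h_def)
    qed
    have Th: "T h x = (1/2) * T f x + (1/2) * T g x" for x
      unfolding h_def
      by (simp only: linear_ops_add[OF T C0_scale C0_scale] linear_ops_scale[OF T] C)
    \<comment> \<open>The average of two numbers in the unit disc has modulus at least 1 only if
      both have modulus 1.\<close>
    have "x \<in> P f \<inter> P g" if "x \<in> P h" for x
    proof -
      have "1 \<le> cmod ((1/2) * T f x + (1/2) * T g x)" using that by (simp add: P_def Th)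
      also have "\<dots> \<le> cmod ((1/2) * T f x) + cmod ((1/2) * T g x)" by (rule norm_triangle_ineq)
      also have "\<dots> = (cmod (T f x) + cmod (T g x)) / 2" by (simp add: norm_mult)
      finally have "2 \<le> cmod (T f x) + cmod (T g x)" by simp
      moreover have "cmod (T f x) \<le> 1" "cmod (T g x) \<le> 1"
        using fg by (auto intro!: le1 simp: F_def)
      ultimately show ?thesis using that by (auto simp: P_def)
    qed
    then show ?thesis using hF by blast
  qed
  have fin: "\<exists>h\<in>F. P h \<subseteq> (\<Inter>f\<in>A. P f)" if "finite A" "A \<noteq> {}" "A \<subseteq> F" for A
    using that
  proof (induction A rule: finite_ne_induct)
    case (insert f A)
    then obtain h where h: "h \<in> F" "P h \<subseteq> (\<Inter>f\<in>A. P f)" by auto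
    with avg[of f h] insert.prems obtain k where "k \<in> F" "P k \<subseteq> P f \<inter> P h" by auto
    with h show ?case by (intro bexI[of _ k]) auto
  qed auto
  obtain p :: "'a \<Rightarrow> real" where p: "(\<lambda>x. complex_of_real (p x)) \<in> C0 \<Omega>" "p y = 1"
    "\<And>x. x \<in> \<Omega> \<Longrightarrow> 0 < p x" "\<And>x. x \<noteq> y \<Longrightarrow> p x < 1"
    using C0_peak_function[OF assms(1,2)] by metis
  define q where "q x = complex_of_real (p x)" for x
  have p01: "0 \<le> p x" "p x \<le> 1" for x
    using p(2) p(3)[of x] p(4)[of x] C0_outside[OF p(1), of x]
    by (cases "x \<in> \<Omega>"; cases "x = y"; force)+
  have qF: "q \<in> F" using p p01 by (auto simp: F_def q_def[abs_def])
  \<comment> \<open>Finite intersection property inside the compact set \<open>P q\<close>.\<close>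
  have "P q \<inter> (\<Inter>f\<in>F. P f) \<noteq> {}"
  proof (rule compact_imp_fip_image[OF P_compact[OF qF]])
    fix A assume A: "finite A" "A \<subseteq> F"
    then obtain h where "h \<in> F" "P h \<subseteq> (\<Inter>f\<in>insert q A. P f)"
      using fin[of "insert q A"] qF by auto
    then show "P q \<inter> (\<Inter>f\<in>A. P f) \<noteq> {}" using P_nonempty[of h] by (simp, blast)
  qed (use P_compact compact_imp_closed in blast)
  then obtain x where x: "x \<in> \<Omega>" "\<And>f. f \<in> F \<Longrightarrow> x \<in> P f" using qF by (auto simp: P_def)
  have one: "cmod (T f x) = 1" if "f \<in> F" for f
    using x(2)[OF that] le1[of f x] that by (auto simp: P_def F_def intro: antisym)
  \<comment> \<open>With \<open>\<bar>f\<bar> \<le> 1\<close>, the function \<open>g = q (1 - \<bar>f\<bar>)\<close> peaks at \<open>y\<close> and \<open>g + c f\<close> is bounded by \<open>1\<close>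
    for every unimodular \<open>c\<close>; choosing the phase of \<open>c\<close> gives \<open>1 + \<bar>T f x\<bar> \<le> 1\<close>.\<close>
  have zero1: "T f x = 0" if f: "f \<in> C0 \<Omega>" "f y = 0" "\<And>z. cmod (f z) \<le> 1" for f
  proof (rule ccontr)
    assume nz: "T f x \<noteq> 0"
    define g where "g z = q z * complex_of_real (1 - cmod (f z))" for z
    have g: "g \<in> C0 \<Omega>"
      unfolding g_def using p(1) f by (intro C0_mult_bounded[where B=1])
        (auto simp: q_def[abs_def] norm_of_real simp del: of_real_diff intro!: continuous_intros C0_continuous)
    have ng: "cmod (g z) = p z * (1 - cmod (f z))" for z
      using f(3)[of z] p01[of z] by (simp add: g_def q_def norm_mult del: of_real_diff)
    have bound: "cmod (g z) + cmod (f z) \<le> 1" for z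
    proof -
      have "p z * (1 - cmod (f z)) \<le> 1 * (1 - cmod (f z))"
        using f(3)[of z] p01[of z] by (intro mult_right_mono) auto
      then show ?thesis by (simp add: ng)
    qed
    have "cmod (g z) \<le> 1" for z using bound[of z] norm_ge_zero[of "f z"] by linarith
    then have "g \<in> F" using g f(2) p(2) by (auto simp: F_def g_def q_def)
    then have Tg: "cmod (T g x) = 1" by (rule one)
    define c where "c = T g x * complex_of_real (cmod (T f x)) / T f x"
    have c: "cmod c = 1" using nz Tg by (simp add: c_def norm_mult norm_divide)
    have "(\<lambda>z. g z + c * f z) \<in> C0 \<Omega>" using g f by (intro C0_add C0_scale)
    moreover have "cmod (g z + c * f z) \<le> 1" for z
      using norm_triangle_ineq[of "g z" "c * f z"] bound[of z] by (simp add: norm_mult c)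
    ultimately have "cmod (T (\<lambda>z. g z + c * f z) x) \<le> 1" by (rule le1)
    moreover have "T (\<lambda>z. g z + c * f z) x = T g x * complex_of_real (1 + cmod (T f x))"
      unfolding linear_ops_add[OF T g C0_scale[OF f(1)]] linear_ops_scale[OF T f(1)]
      using nz by (simp add: c_def algebra_simps)
    ultimately have "\<bar>1 + cmod (T f x)\<bar> \<le> 1" by (simp add: norm_mult Tg del: of_real_add)
    then show False using nz by simp
  qed
  have zero: "T f x = 0" if f: "f \<in> C0 \<Omega>" "f y = 0" for f
  proof -
    obtain B where B: "0 \<le> B" "\<And>z. cmod (f z) \<le> B" using C0_bounded[OF f(1)] by blast
    \<comment> \<open>Scaling into the unit ball; \<open>B + 1\<close> is nonzero even if
      \<open>B = 0\<close>.\<close>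
    define r where "r = complex_of_real (1 / (B + 1))"
    have "cmod (r * f z) \<le> 1" for z
      using B(1) B(2)[of z] by (simp add: r_def norm_mult norm_divide field_simps del: of_real_add of_real_divide)
    then have "T (\<lambda>z. r * f z) x = 0" using f by (intro zero1 C0_scale) auto
    moreover have "r \<noteq> 0" using B(1) by (simp add: r_def del: of_real_add of_real_divide)
    ultimately show ?thesis using linear_ops_scale[OF T f(1), of r] by simp
  qed
  have qC: "q \<in> C0 \<Omega>" using qF by (simp add: F_def)
  have "cmod (T f x) = cmod (f y)" if f: "f \<in> C0 \<Omega>" for f
  proof -
    \<comment> \<open>Since \<open>q y = 1\<close>, subtracting \<open>f y\<close> times
      \<open>q\<close> gives a function vanishing at \<open>y\<close>.\<close>
    have "T (\<lambda>z. f z + (- f y) * q z) x = 0"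
      using p(2) by (intro zero C0_add C0_scale f qC) (simp add: q_def)
    then have "T f x + (- f y) * T q x = 0"
      by (simp only: linear_ops_add[OF T f C0_scale[OF qC]] linear_ops_scale[OF T qC])
    then have "T f x = f y * T q x" by (simp add: algebra_simps)
    then show ?thesis using one[OF qF] by (simp add: norm_mult)
  qed
  then show ?thesis using x(1) by blast
qed

lemma isometry_inj_on:
  fixes \<Omega> :: "'a::t2_space set"
  assumes T: "T \<in> linear_ops (C0 \<Omega>)"
    and iso: "\<And>f. f \<in> C0 \<Omega> \<Longrightarrow> supnorm \<Omega> (T f) = supnorm \<Omega> f"
  shows "inj_on T (C0 \<Omega>)"
proof (rule inj_onI)
  fix f g assume fg: "f \<in> C0 \<Omega>" "g \<in> C0 \<Omega>" "T f = T g"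
  define d where "d = (\<lambda>x. f x + (-1) * g x)"
  have d: "d \<in> C0 \<Omega>" unfolding d_def using fg by (intro C0_add C0_scale)
  have "T d = (\<lambda>x. T f x + (-1) * T g x)"
    unfolding d_def by (simp only: linear_ops_add[OF T fg(1) C0_scale[OF fg(2)]] linear_ops_scale[OF T fg(2)])
  then have "supnorm \<Omega> d \<le> 0" using iso[OF d] fg(3) supnorm_le[of 0 \<Omega> "T d"] by simp
  then have "cmod (d x) \<le> 0" for x by (rule order_trans[OF cmod_le_supnorm[OF d]])
  then show "f = g" by (auto simp: d_def fun_eq_iff)
qed

lemma Iso_inj_on:
  fixes \<Omega> :: "'a::t2_space set"
  shows "S \<in> Iso (C0 \<Omega>) (supnorm \<Omega>) \<Longrightarrow> inj_on S (C0 \<Omega>)"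
  by (rule isometry_inj_on) (auto simp: Iso_def)

text \<open>Applying \<open>isometry_evaluation\<close> to the inverse of \<open>S\<close> reverses
  the direction: here \<open>x\<close> is arbitrary and \<open>y\<close> is found.\<close>

lemma Iso_evaluation:
  fixes \<Omega> :: "'a::euclidean_space set"
  assumes "open \<Omega>" "x \<in> \<Omega>" and S: "S \<in> Iso (C0 \<Omega>) (supnorm \<Omega>)"
  shows "\<exists>y\<in>\<Omega>. \<forall>f\<in>C0 \<Omega>. cmod (S f x) = cmod (f y)"
proof -
  let ?V = "C0 \<Omega>"
  have bij: "bij_betw S ?V ?V"
    using Iso_inj_on[OF S] S by (auto simp: bij_betw_def Iso_def)
  define R where "R = restrict (inv_into ?V S) ?V"
  have RS: "R (S f) = f" if "f \<in> ?V" for f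
    using bij that by (auto simp: R_def bij_betw_def)
  have "R \<in> linear_ops ?V"
    unfolding R_def using S bij by (intro inverse_linear_ops C0_add C0_scale) (auto simp: Iso_def)
  moreover have "supnorm \<Omega> (R g) = supnorm \<Omega> g" if g: "g \<in> ?V" for g
  proof -
    obtain f where "f \<in> ?V" "g = S f" using bij g by (auto simp: bij_betw_def)
    then show ?thesis using S by (simp add: RS Iso_def)
  qed
  ultimately obtain y where y: "y \<in> \<Omega>" "\<forall>g\<in>?V. cmod (R g y) = cmod (g x)"
    using isometry_evaluation[OF assms(1,2)] by metis
  have "cmod (S f x) = cmod (f y)" if "f \<in> ?V" for f
    using y(2) RS[OF that] bij that by (metis bij_betwE)
  then show ?thesis using y(1) by blast
qed

section \<open>Local isometries\<close>

text \<open>Outside the ball, the compact level set at height \<open>1/2\<close> carries a maximum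
  of the modulus, which is below 1. This serves to prove continuity of the map of peak
  points.\<close>

lemma C0_strict_peak_neighbourhood:
  fixes \<Omega> :: "'a::metric_space set"
  assumes g: "g \<in> C0 \<Omega>" and peak: "\<And>z. z \<in> \<Omega> \<Longrightarrow> z \<noteq> x \<Longrightarrow> cmod (g z) < 1" and "0 < e"
  obtains m where "m < 1" "\<And>z. z \<in> \<Omega> \<Longrightarrow> m < cmod (g z) \<Longrightarrow> dist z x < e"
proof -
  define K where "K = {z\<in>\<Omega>. 1/2 \<le> cmod (g z)} - ball x e"
  have comp: "compact K" unfolding K_def using g by (intro compact_diff C0_compact_level) auto
  have cont: "continuous_on K (\<lambda>z. cmod (g z))"
    by (intro continuous_on_norm continuous_on_subset[OF C0_continuous[OF g]]) (auto simp: K_def)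
  show ?thesis
  proof (cases "K = {}")
    case True
    show ?thesis by (rule that[of "1/2"]) (use True in \<open>auto simp: K_def dist_commute\<close>)
  next
    case False
    then obtain k where k: "k \<in> K" "\<And>z. z \<in> K \<Longrightarrow> cmod (g z) \<le> cmod (g k)"
      using continuous_attains_sup[OF comp False cont] by metis
    have "cmod (g k) < 1" using k(1) peak[of k] \<open>0 < e\<close> by (cases "k = x") (auto simp: K_def)
    then show ?thesis
    \<comment> \<open>The bound \<open>1/2\<close> puts \<open>z\<close> into the level set, and the
      bound at \<open>k\<close> then keeps it out of \<open>K\<close>.\<close>
    proof (intro that[of "max (1/2) (cmod (g k))"])
      fix z assume "z \<in> \<Omega>" "max (1/2) (cmod (g k)) < cmod (g z)"
      then show "dist z x < e" using k(2)[of z] by (force simp: K_def dist_commute)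
    qed auto
  qed
qed

lemma local_isometry_weighted_composition:
  fixes \<Omega> :: "'a::euclidean_space set"
  assumes "open \<Omega>" "connected \<Omega>"
    and T: "T \<in> ref_al (C0 \<Omega>) (supnorm \<Omega>) (Iso (C0 \<Omega>) (supnorm \<Omega>))"
  obtains c \<phi> \<psi> where "homeomorphism \<Omega> \<Omega> \<phi> \<psi>" "continuous_on \<Omega> c"
    "\<And>x. x \<in> \<Omega> \<Longrightarrow> cmod (c x) = 1"
    "\<And>f x. f \<in> C0 \<Omega> \<Longrightarrow> x \<in> \<Omega> \<Longrightarrow> T f x = c x * f (\<phi> x)"
proof (cases "\<Omega> = {}")
  case True
  \<comment> \<open>The empty set is split off because a base point is chosen below.\<close>
  then show ?thesis by (intro that[of id id "\<lambda>_. 1"]) (auto simp: homeomorphism_def)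
next
  case False
  let ?V = "C0 \<Omega>"
  have lin: "T \<in> linear_ops ?V" using T by (auto simp: ref_al_def bounded_ops_def)
  note TV = linear_ops_closed[OF lin]
  have loc: "\<exists>S\<in>Iso ?V (supnorm \<Omega>). T f = S f" if "f \<in> ?V" for f
    using T that by (auto simp: ref_al_def)
  have iso: "supnorm \<Omega> (T f) = supnorm \<Omega> f" if "f \<in> ?V" for f
    using loc[OF that] that by (auto simp: Iso_def)
  have "\<forall>y\<in>\<Omega>. \<exists>x\<in>\<Omega>. \<forall>f\<in>?V. cmod (T f x) = cmod (f y)"
    using isometry_evaluation[OF assms(1) _ lin iso] by blast
  then obtain \<psi> where \<psi>: "\<And>y. y \<in> \<Omega> \<Longrightarrow> \<psi> y \<in> \<Omega>"
    "\<And>y f. y \<in> \<Omega> \<Longrightarrow> f \<in> ?V \<Longrightarrow> cmod (T f (\<psi> y)) = cmod (f y)" by metis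
  have "\<forall>y\<in>\<Omega>. \<exists>p. (\<lambda>x. complex_of_real (p x)) \<in> ?V \<and> p y = 1 \<and>
      (\<forall>x\<in>\<Omega>. 0 < p x) \<and> (\<forall>x. x \<noteq> y \<longrightarrow> p x < 1)"
    using C0_peak_function[OF assms(1)] by metis
  then obtain p where p: "\<And>y. y \<in> \<Omega> \<Longrightarrow> (\<lambda>x. complex_of_real (p y x)) \<in> ?V"
    "\<And>y. y \<in> \<Omega> \<Longrightarrow> p y y = 1" "\<And>x y. y \<in> \<Omega> \<Longrightarrow> x \<in> \<Omega> \<Longrightarrow> 0 < p y x"
    "\<And>x y. y \<in> \<Omega> \<Longrightarrow> x \<noteq> y \<Longrightarrow> p y x < 1" by metis
  define q where "q y x = complex_of_real (p y x)" for x y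
  have q: "q y \<in> ?V" if "y \<in> \<Omega>" for y using p(1)[OF that] by (simp add: q_def[abs_def])
  have q_norm: "cmod (q y x) = p y x" if "y \<in> \<Omega>" "x \<in> \<Omega>" for x y
    using p(3)[OF that] by (simp add: q_def)
  \<comment> \<open>Let \<open>S\<close> be a surjective isometry agreeing with \<open>T\<close> at
    \<open>q y\<close>. At both points the modulus of \<open>S f\<close> equals that of
    \<open>f y\<close> for every \<open>f\<close>, so no image under \<open>S\<close> separates them
    in modulus; but \<open>q x\<close> does, and it is such an image.\<close>
  have unique_peak: "x = x'"
    if y: "y \<in> \<Omega>" and x: "x \<in> \<Omega>" "x' \<in> \<Omega>" "cmod (T (q y) x) = 1" "cmod (T (q y) x') = 1" for x x' y
  proof (rule ccontr)
    assume "x \<noteq> x'"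
    obtain S where S: "S \<in> Iso ?V (supnorm \<Omega>)" "T (q y) = S (q y)" using loc[OF q[OF y]] by blast
    have eval: "cmod (S f z) = cmod (f y)"
      if z: "z \<in> \<Omega>" "cmod (T (q y) z) = 1" and f: "f \<in> ?V" for f z
    proof -
      obtain w where w: "w \<in> \<Omega>" "\<forall>f\<in>?V. cmod (S f z) = cmod (f w)"
        using Iso_evaluation[OF assms(1) z(1) S(1)] by blast
      then have "p y w = 1" using q[OF y] z S(2) q_norm[OF y w(1)] by auto
      then have "w = y" using p(4)[OF y, of w] by auto
      then show ?thesis using w(2) f by simp
    qed
    obtain f where f: "f \<in> ?V" "S f = q x" using S(1) q[OF x(1)] by (force simp: Iso_def)
    have "cmod (q x x) = cmod (q x x')" using eval[of x f] eval[of x' f] x f by simp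
    then show False using q_norm x p(2)[of x] p(4)[of x x'] \<open>x \<noteq> x'\<close> by auto
  qed
  have peak: "cmod (T (q y) x) < 1" if "y \<in> \<Omega>" "x \<in> \<Omega>" "x \<noteq> \<psi> y" for x y
  proof -
    have "p y z \<le> 1" for z
      using p(2)[OF that(1)] p(4)[OF that(1), of z] by (cases "z = y") auto
    then have "supnorm \<Omega> (q y) \<le> 1" by (intro supnorm_le) (auto simp: q_norm that(1))
    then have "cmod (T (q y) x) \<le> 1"
      using cmod_le_supnorm[OF TV[OF q[OF that(1)]], of x] iso[OF q[OF that(1)]] by simp
    moreover have "cmod (T (q y) (\<psi> y)) = 1" using \<psi>(2)[OF that(1) q[OF that(1)]] that(1) p(2)
      by (simp add: q_norm)
    ultimately show ?thesis using unique_peak[OF that(1,2) \<psi>(1)[OF that(1)]] that(3) by fastforce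
  qed
  \<comment> \<open>If \<psi> identified \<open>y\<close> and \<open>z\<close>, every function would
    have equal moduli there, contrary to \<open>q y\<close>.\<close>
  have inj: "inj_on \<psi> \<Omega>"
  proof (rule inj_onI, rule ccontr)
    fix y z assume yz: "y \<in> \<Omega>" "z \<in> \<Omega>" "\<psi> y = \<psi> z" "y \<noteq> z"
    then have "p y y = p y z"
      using \<psi>(2)[of y "q y"] \<psi>(2)[of z "q y"] by (simp add: q q_norm)
    then show False using p(2)[of y] p(4)[of y z] yz by simp
  qed
  \<comment> \<open>For \<open>z\<close> near \<open>y\<close>, the modulus of
    \<open>T (q y)\<close> at \<open>\<psi> z\<close> is \<open>p y z\<close>, close to 1; the
    strict peak of \<open>T (q y)\<close> then forces \<open>\<psi> z\<close> near
    \<open>\<psi> y\<close>.\<close>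
  have cont: "continuous_on \<Omega> \<psi>"
    unfolding continuous_on_iff
  proof (intro ballI allI impI)
    fix y and e :: real assume y: "y \<in> \<Omega>" and e: "0 < e"
    obtain m where m: "m < 1" "\<And>z. z \<in> \<Omega> \<Longrightarrow> m < cmod (T (q y) z) \<Longrightarrow> dist z (\<psi> y) < e"
      using C0_strict_peak_neighbourhood[OF TV[OF q[OF y]] peak[OF y] e] by metis
    have "continuous_on \<Omega> (\<lambda>z. cmod (q y z))"
      by (intro continuous_on_norm C0_continuous q y)
    then obtain d where d: "0 < d" "\<forall>z\<in>\<Omega>. dist z y < d \<longrightarrow> dist (cmod (q y z)) (cmod (q y y)) < 1 - m"
      unfolding continuous_on_iff using y m(1) by (metis diff_gt_0_iff_gt)
    have "dist (\<psi> z) (\<psi> y) < e" if z: "z \<in> \<Omega>" "dist z y < d" for z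
    proof (rule m(2)[OF \<psi>(1)[OF z(1)]])
      have "\<bar>p y z - 1\<bar> < 1 - m" using d(2) z y p(2)[OF y] by (auto simp: q_norm dist_real_def)
      then show "m < cmod (T (q y) (\<psi> z))" using z y by (simp add: \<psi>(2) q q_norm)
    qed
    then show "\<exists>d>0. \<forall>z\<in>\<Omega>. dist z y < d \<longrightarrow> dist (\<psi> z) (\<psi> y) < e" using d(1) by blast
  qed
  obtain y0 where y0: "y0 \<in> \<Omega>" using False by blast
  \<comment> \<open>A function without zeros on \<Omega>: it serves to show that the image of \<psi>
    is closed in \<Omega>, and later as the denominator of the weight.\<close>
  define h where "h = q y0"
  have h: "h \<in> ?V" using q[OF y0] by (simp add: h_def)
  have h0: "h x \<noteq> 0" if "x \<in> \<Omega>" for x using p(3)[OF y0 that] by (simp add: h_def q_def)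
  have Th0: "T h x \<noteq> 0" if x: "x \<in> \<Omega>" for x
  proof -
    obtain S where S: "S \<in> Iso ?V (supnorm \<Omega>)" "T h = S h" using loc[OF h] by blast
    obtain w where "w \<in> \<Omega>" "cmod (S h x) = cmod (h w)"
      using Iso_evaluation[OF assms(1) x S(1)] h by blast
    then show ?thesis using h0 S(2) by (metis norm_eq_zero)
  qed
  have open_image: "open (\<psi> ` \<Omega>)" using invariance_of_domain[OF cont assms(1) inj] .
  \<comment> \<open>The image is also closed in \<open>\<Omega>\<close>: near a point \<open>x\<close>, where \<open>T h\<close> is bounded away from \<open>0\<close>, it
    coincides with the image of a compact level set of \<open>h\<close>.\<close>
  have "open (\<Omega> - \<psi> ` \<Omega>)"
  proof (subst open_subopen, intro ballI)
    fix x assume x: "x \<in> \<Omega> - \<psi> ` \<Omega>"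
    define d where "d = cmod (T h x) / 2"
    have d: "0 < d" using Th0[of x] x by (simp add: d_def)
    define K where "K = {y\<in>\<Omega>. d \<le> cmod (h y)}"
    have "compact (\<psi> ` K)" unfolding K_def
      by (intro compact_continuous_image C0_compact_level h d continuous_on_subset[OF cont]) auto
    then have "closed (\<psi> ` K)" by (rule compact_imp_closed)
    moreover have "open (\<Omega> \<inter> (\<lambda>z. cmod (T h z)) -` {d<..})"
      by (intro continuous_open_preimage continuous_on_norm C0_continuous TV h assms) auto
    ultimately have "open (\<Omega> \<inter> (\<lambda>z. cmod (T h z)) -` {d<..} - \<psi> ` K)" (is "open ?U")
      by (rule open_Diff[rotated])
    moreover have "x \<in> ?U" using x d by (auto simp: d_def K_def)
    moreover have "?U \<subseteq> \<Omega> - \<psi> ` \<Omega>" using \<psi>(2)[OF _ h] by (auto simp: K_def)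
    ultimately show "\<exists>U. open U \<and> x \<in> U \<and> U \<subseteq> \<Omega> - \<psi> ` \<Omega>" by blast
  qed
  then have "\<psi> ` \<Omega> \<inter> \<Omega> = {} \<or> (\<Omega> - \<psi> ` \<Omega>) \<inter> \<Omega> = {}"
    by (rule connectedD[OF assms(2) open_image]) auto
  then have onto: "\<psi> ` \<Omega> = \<Omega>" using False \<psi>(1) by auto
  obtain \<phi> where hom: "homeomorphism \<Omega> \<Omega> \<psi> \<phi>"
    using invariance_of_domain_homeomorphism[OF assms(1) cont _ inj] onto by auto
  then have \<phi>: "\<phi> x \<in> \<Omega>" "\<psi> (\<phi> x) = x" if "x \<in> \<Omega>" for x
    using that by (auto simp: homeomorphism_def)
  \<comment> \<open>The only weight possible, as the desired formula must hold at
    \<open>h\<close>.\<close>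
  define c where "c x = T h x / h (\<phi> x)" for x
  show ?thesis
  proof (rule that)
    show "homeomorphism \<Omega> \<Omega> \<phi> \<psi>" using hom by (rule homeomorphism_symD)
    have "continuous_on \<Omega> (\<lambda>x. h (\<phi> x))"
      using hom by (intro continuous_on_compose2[OF C0_continuous[OF h]]) (auto simp: homeomorphism_def)
    then show "continuous_on \<Omega> c"
      unfolding c_def using h0 \<phi>(1)
      by (intro continuous_on_divide[OF C0_continuous[OF TV[OF h]]]) auto
    show "cmod (c x) = 1" if "x \<in> \<Omega>" for x
      using \<psi>(2)[OF \<phi>(1)[OF that] h] \<phi>[OF that] h0[of "\<phi> x"] by (simp add: c_def norm_divide)
    fix f x assume f: "f \<in> ?V" and x: "x \<in> \<Omega>"
    \<comment> \<open>With this \<open>r\<close>, \<open>f + r h\<close> vanishes at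
      \<open>\<phi> x\<close>, so its image under \<open>T\<close> vanishes at
      \<open>x\<close>.\<close>
    define r where "r = - (f (\<phi> x) / h (\<phi> x))"
    have "cmod (T (\<lambda>z. f z + r * h z) (\<psi> (\<phi> x))) = cmod (f (\<phi> x) + r * h (\<phi> x))"
      using \<phi>(1)[OF x] f h by (intro \<psi>(2) C0_add C0_scale)
    also have "\<dots> = 0" using h0[OF \<phi>(1)[OF x]] by (simp add: r_def)
    finally have "T f x + r * T h x = 0"
      by (simp add: \<phi>(2)[OF x] linear_ops_add[OF lin f C0_scale[OF h]] linear_ops_scale[OF lin h])
    then show "T f x = c x * f (\<phi> x)" by (simp add: r_def c_def field_simps)
  qed
qed

text \<open>The substance is surjectivity: \<open>g\<close> has as preimage the quotient
  \<open>g / c\<close> composed with \<psi>.\<close>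

lemma weighted_composition_Iso:
  fixes \<Omega> :: "'a::t2_space set"
  assumes lin: "T \<in> linear_ops (C0 \<Omega>)" and hom: "homeomorphism \<Omega> \<Omega> \<phi> \<psi>"
    and c: "continuous_on \<Omega> c" "\<And>x. x \<in> \<Omega> \<Longrightarrow> cmod (c x) = 1"
    and T: "\<And>f x. f \<in> C0 \<Omega> \<Longrightarrow> x \<in> \<Omega> \<Longrightarrow> T f x = c x * f (\<phi> x)"
  shows "T \<in> Iso (C0 \<Omega>) (supnorm \<Omega>)"
proof -
  note TV = linear_ops_closed[OF lin]
  have \<phi>: "\<phi> x \<in> \<Omega>" "\<psi> (\<phi> x) = x" and \<psi>: "\<psi> x \<in> \<Omega>" "\<phi> (\<psi> x) = x" if "x \<in> \<Omega>" for x
    using that hom by (auto simp: homeomorphism_def)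
  have "supnorm \<Omega> (T f) = supnorm \<Omega> f" if f: "f \<in> C0 \<Omega>" for f
  proof (rule antisym)
    have nonneg: "0 \<le> supnorm \<Omega> g" if "g \<in> C0 \<Omega>" for g
      using order_trans[OF norm_ge_zero cmod_le_supnorm[OF that]] .
    show "supnorm \<Omega> (T f) \<le> supnorm \<Omega> f"
      using f nonneg[OF f] by (intro supnorm_le) (auto simp: T norm_mult c cmod_le_supnorm)
    show "supnorm \<Omega> f \<le> supnorm \<Omega> (T f)"
    proof (rule supnorm_le)
      fix y assume y: "y \<in> \<Omega>"
      have "cmod (T f (\<psi> y)) = cmod (f y)" using y f by (simp add: T norm_mult c \<psi>)
      then show "cmod (f y) \<le> supnorm \<Omega> (T f)" using cmod_le_supnorm[OF TV[OF f], of "\<psi> y"] by simp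
    qed (use nonneg TV[OF f] in auto)
  qed
  moreover have "g \<in> T ` C0 \<Omega>" if g: "g \<in> C0 \<Omega>" for g
  proof -
    define f where "f y = (if y \<in> \<Omega> then g (\<psi> y) / c (\<psi> y) else 0)" for y
    have norm_f: "cmod (f y) = cmod (g (\<psi> y))" if "y \<in> \<Omega>" for y
      using that \<psi>(1) c(2) by (simp add: f_def norm_divide)
    have f: "f \<in> C0 \<Omega>"
    proof (rule C0I)
      have cont: "continuous_on \<Omega> (\<lambda>y. a (\<psi> y))" if "continuous_on \<Omega> a" for a :: "'a \<Rightarrow> complex"
        using hom by (intro continuous_on_compose2[OF that]) (auto simp: homeomorphism_def)
      have "continuous_on \<Omega> (\<lambda>y. g (\<psi> y) / c (\<psi> y))"
        using c(2) \<psi>(1) by (intro continuous_on_divide cont C0_continuous[OF g] c(1)) force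
      then show "continuous_on \<Omega> f"
        by (rule continuous_on_eq) (simp add: f_def)
      fix e :: real assume e: "0 < e"
      \<comment> \<open>The weight is unimodular, so level sets of \<open>f\<close> are images of
        compact level sets of \<open>g\<close> under \<phi>.\<close>
      have "{x\<in>\<Omega>. e \<le> cmod (f x)} = \<phi> ` {x\<in>\<Omega>. e \<le> cmod (g x)}"
      proof (intro set_eqI iffI)
        fix y assume y: "y \<in> {x\<in>\<Omega>. e \<le> cmod (f x)}"
        then have "\<psi> y \<in> {x\<in>\<Omega>. e \<le> cmod (g x)}" using norm_f[of y] \<psi>(1)[of y] by simp
        then show "y \<in> \<phi> ` {x\<in>\<Omega>. e \<le> cmod (g x)}"
          using y \<psi>(2)[of y] by (metis (no_types, lifting) imageI mem_Collect_eq)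
      next
        fix y assume "y \<in> \<phi> ` {x\<in>\<Omega>. e \<le> cmod (g x)}"
        then obtain x where "x \<in> \<Omega>" "e \<le> cmod (g x)" "y = \<phi> x" by blast
        then show "y \<in> {x\<in>\<Omega>. e \<le> cmod (f x)}" using norm_f[of y] \<phi>[of x] by simp
      qed
      moreover have "compact (\<phi> ` {x\<in>\<Omega>. e \<le> cmod (g x)})"
        by (intro compact_continuous_image C0_compact_level g e
            continuous_on_subset[OF homeomorphism_cont1[OF hom]]) auto
      ultimately show "compact {x\<in>\<Omega>. e \<le> cmod (f x)}" by simp
    qed (simp add: f_def)
    have "T f = g"
    proof (rule C0_eqI[OF TV[OF f] g])
      fix x assume x: "x \<in> \<Omega>"
      then have "c x \<noteq> 0" using c(2) by force
      then show "T f x = g x" using f x by (simp add: T f_def \<phi>)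
    qed
    then show ?thesis using f by blast
  qed
  ultimately show ?thesis using lin TV by (auto simp: Iso_def)
qed

section \<open>Reflexivity of the isometry group\<close>

lemma Iso_subset_bounded_ops: "Iso V N \<subseteq> bounded_ops V N"
proof
  fix T assume T: "T \<in> Iso V N"
  then have "\<forall>f\<in>V. N (T f) \<le> 1 * N f" by (simp add: Iso_def)
  with T show "T \<in> bounded_ops V N" unfolding bounded_ops_def Iso_def by blast
qed

lemma subset_ref_al: "E \<subseteq> bounded_ops V N \<Longrightarrow> E \<subseteq> ref_al V N E"
  by (auto simp: ref_al_def)

theorem Iso_C0_algebraically_reflexive:
  fixes \<Omega> :: "'a::euclidean_space set"
  assumes "open \<Omega>" "connected \<Omega>"
  shows "algebraically_reflexive (C0 \<Omega>) (supnorm \<Omega>) (Iso (C0 \<Omega>) (supnorm \<Omega>))"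
  unfolding algebraically_reflexive_def
proof
  show "ref_al (C0 \<Omega>) (supnorm \<Omega>) (Iso (C0 \<Omega>) (supnorm \<Omega>)) \<subseteq> Iso (C0 \<Omega>) (supnorm \<Omega>)"
  proof
    fix T assume T: "T \<in> ref_al (C0 \<Omega>) (supnorm \<Omega>) (Iso (C0 \<Omega>) (supnorm \<Omega>))"
    then have lin: "T \<in> linear_ops (C0 \<Omega>)" by (auto simp: ref_al_def bounded_ops_def)
    from local_isometry_weighted_composition[OF assms T] weighted_composition_Iso[OF lin]
    show "T \<in> Iso (C0 \<Omega>) (supnorm \<Omega>)" by metis
  qed
qed (intro subset_ref_al Iso_subset_bounded_ops)

section \<open>Automorphisms\<close>

text \<open>The witness is \<open>f / (l - f)\<close>. The equation expresses invertibility of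
  \<open>l - f\<close> without a unit, so multiplicative linear maps transport it.\<close>

lemma C0_quasi_inverse:
  assumes f: "f \<in> C0 \<Omega>" and l: "l \<noteq> 0" "l \<notin> f ` \<Omega>"
  obtains g where "g \<in> C0 \<Omega>" "f = (\<lambda>x. l * g x + (-1) * (g x * f x))"
proof -
  define g where "g x = f x / (l - f x)" for x
  have nz: "l - f x \<noteq> 0" for x
    using l C0_outside[OF f, of x] by (cases "x \<in> \<Omega>") auto
  have "g \<in> C0 \<Omega>"
  proof (rule C0_dominated[OF f])
    show "continuous_on \<Omega> g"
      unfolding g_def using nz by (intro continuous_intros C0_continuous f) auto
    fix e :: real assume e: "0 < e"
    show "\<exists>d>0. \<forall>x\<in>\<Omega>. cmod (f x) < d \<longrightarrow> cmod (g x) < e"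
    \<comment> \<open>The constant solves \<open>d = e * (cmod l - d)\<close>.\<close>
    proof (intro exI[of _ "e * cmod l / (1 + e)"] conjI ballI impI)
      fix x assume "cmod (f x) < e * cmod l / (1 + e)"
      then have "cmod (f x) < e * (cmod l - cmod (f x))" using e by (simp add: field_simps)
      also have "\<dots> \<le> e * cmod (l - f x)"
        using e norm_triangle_ineq2[of l "f x"] by (intro mult_left_mono) auto
      finally show "cmod (g x) < e" using nz[of x] by (simp add: g_def norm_divide field_simps)
    qed (use e l in auto)
  qed (use C0_outside[OF f] in \<open>auto simp: g_def\<close>)
  moreover have "f x = l * g x + (-1) * (g x * f x)" for x
  proof -
    have "(l - f x) * g x = f x" using nz[of x] by (simp add: g_def)
    then show ?thesis by (simp add: algebra_simps)
  qed
  ultimately show ?thesis using that by blast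
qed

text \<open>A nonzero \<open>l\<close> is a value of \<open>f\<close> exactly if
  \<open>f = l g - g f\<close> has no solution \<open>g\<close> in the algebra, a condition that
  automorphisms respect. The test concerns nonzero \<open>l\<close> only, hence the inserted
  \<open>0\<close>.\<close>

lemma Aut_range:
  fixes \<Omega> :: "'a::t2_space set"
  assumes S: "S \<in> Aut (C0 \<Omega>)" and f: "f \<in> C0 \<Omega>"
  shows "insert 0 (S f ` \<Omega>) = insert 0 (f ` \<Omega>)"
proof -
  have lin: "S \<in> linear_ops (C0 \<Omega>)" and bij: "bij_betw S (C0 \<Omega>) (C0 \<Omega>)"
    and mult: "\<And>f g. f \<in> C0 \<Omega> \<Longrightarrow> g \<in> C0 \<Omega> \<Longrightarrow> S (\<lambda>x. f x * g x) = (\<lambda>x. S f x * S g x)"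
    using S by (auto simp: Aut_def)
  have quasi: "S (\<lambda>x. l * g x + (-1) * (g x * f x)) = (\<lambda>x. l * S g x + (-1) * (S g x * S f x))"
    if g: "g \<in> C0 \<Omega>" for g l
    by (simp only: linear_ops_add[OF lin C0_scale[OF g] C0_scale[OF C0_mult[OF g f]]]
        linear_ops_scale[OF lin g] linear_ops_scale[OF lin C0_mult[OF g f]] mult[OF g f])
  \<comment> \<open>At \<open>x0\<close> the two terms on the right cancel, leaving
    \<open>h x0 = 0\<close>.\<close>
  have no_quasi: False if "h = (\<lambda>x. h x0 * g x + (-1) * (g x * h x))" "h x0 \<noteq> 0"
    for h g :: "'a \<Rightarrow> complex" and x0
    using fun_cong[OF that(1), of x0] that(2) by simp
  have "S f x \<in> insert 0 (f ` \<Omega>)" for x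
  proof (rule ccontr)
    assume "S f x \<notin> insert 0 (f ` \<Omega>)"
    then have l: "S f x \<noteq> 0" "S f x \<notin> f ` \<Omega>" by auto
    obtain g where g: "g \<in> C0 \<Omega>" "f = (\<lambda>z. S f x * g z + (-1) * (g z * f z))"
      using C0_quasi_inverse[OF f l] by blast
    have "S f = (\<lambda>z. S f x * S g z + (-1) * (S g z * S f z))"
      using arg_cong[OF g(2), of S] unfolding quasi[OF g(1)] .
    then show False using l(1) by (rule no_quasi)
  qed
  moreover have "f x \<in> insert 0 (S f ` \<Omega>)" for x
  proof (rule ccontr)
    assume "f x \<notin> insert 0 (S f ` \<Omega>)"
    then have l: "f x \<noteq> 0" "f x \<notin> S f ` \<Omega>" by auto
    obtain g' where g': "g' \<in> C0 \<Omega>" "S f = (\<lambda>z. f x * g' z + (-1) * (g' z * S f z))"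
      using C0_quasi_inverse[OF linear_ops_closed[OF lin f] l] by blast
    \<comment> \<open>Surjectivity pulls the solution back along \<open>S\<close>; injectivity then
      cancels \<open>S\<close> from the equation.\<close>
    obtain g where g: "g \<in> C0 \<Omega>" "g' = S g"
      using bij g'(1) by (auto simp: bij_betw_def)
    have "S f = S (\<lambda>z. f x * g z + (-1) * (g z * f z))"
      using g'(2) unfolding g(2) quasi[OF g(1)] .
    moreover have "(\<lambda>z. f x * g z + (-1) * (g z * f z)) \<in> C0 \<Omega>"
      using g f by (intro C0_add C0_scale C0_mult)
    ultimately have "f = (\<lambda>z. f x * g z + (-1) * (g z * f z))"
      using bij f by (auto simp: bij_betw_def dest: inj_onD)
    then show False using l(1) by (rule no_quasi)
  qed
  ultimately show ?thesis by blast
qed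

text \<open>The norm depends only on the set of values together with \<open>0\<close>, which
  automorphisms preserve. Boundedness of automorphisms follows.\<close>

lemma Aut_subset_Iso:
  fixes \<Omega> :: "'a::t2_space set"
  shows "Aut (C0 \<Omega>) \<subseteq> Iso (C0 \<Omega>) (supnorm \<Omega>)"
proof
  fix S assume S: "S \<in> Aut (C0 \<Omega>)"
  have "supnorm \<Omega> g = Sup (cmod ` insert 0 (g ` \<Omega>))" for g
    by (simp add: supnorm_def image_image)
  then have "supnorm \<Omega> (S f) = supnorm \<Omega> f" if "f \<in> C0 \<Omega>" for f
    using Aut_range[OF S that] by (simp only:)
  then show "S \<in> Iso (C0 \<Omega>) (supnorm \<Omega>)"
    using S by (auto simp: Aut_def Iso_def bij_betw_def)
qed

section \<open>Reflexivity of the automorphism group\<close>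

theorem Aut_C0_algebraically_reflexive:
  fixes \<Omega> :: "'a::euclidean_space set"
  assumes "open \<Omega>" "connected \<Omega>"
  shows "algebraically_reflexive (C0 \<Omega>) (supnorm \<Omega>) (Aut (C0 \<Omega>))"
  unfolding algebraically_reflexive_def
proof
  show "ref_al (C0 \<Omega>) (supnorm \<Omega>) (Aut (C0 \<Omega>)) \<subseteq> Aut (C0 \<Omega>)"
  proof
    fix T assume T: "T \<in> ref_al (C0 \<Omega>) (supnorm \<Omega>) (Aut (C0 \<Omega>))"
    then have lin: "T \<in> linear_ops (C0 \<Omega>)" by (auto simp: ref_al_def bounded_ops_def)
    have Tref: "T \<in> ref_al (C0 \<Omega>) (supnorm \<Omega>) (Iso (C0 \<Omega>) (supnorm \<Omega>))"
      using T Aut_subset_Iso[of \<Omega>] by (force simp: ref_al_def)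
    obtain c \<phi> \<psi> where hom: "homeomorphism \<Omega> \<Omega> \<phi> \<psi>" and c: "continuous_on \<Omega> c"
      "\<And>x. x \<in> \<Omega> \<Longrightarrow> cmod (c x) = 1"
      and Tc: "\<And>f x. f \<in> C0 \<Omega> \<Longrightarrow> x \<in> \<Omega> \<Longrightarrow> T f x = c x * f (\<phi> x)"
      using local_isometry_weighted_composition[OF assms Tref] by metis
    have Iso: "T \<in> Iso (C0 \<Omega>) (supnorm \<Omega>)"
      using weighted_composition_Iso[OF lin hom c Tc] .
    \<comment> \<open>Testing on a positive function with value 1 at \<open>\<phi> x\<close>
      exhibits \<open>c x\<close> as one of its values or \<open>0\<close>, hence as a nonnegative
      real; its modulus is 1.\<close>
    have c1: "c x = 1" if x: "x \<in> \<Omega>" for x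
    proof -
      have y: "\<phi> x \<in> \<Omega>" using x hom by (auto simp: homeomorphism_def)
      obtain p :: "'a \<Rightarrow> real" where p: "(\<lambda>z. complex_of_real (p z)) \<in> C0 \<Omega>" "p (\<phi> x) = 1"
        "\<And>z. z \<in> \<Omega> \<Longrightarrow> 0 < p z"
        using C0_peak_function[OF assms(1) y] by metis
      obtain S where S: "S \<in> Aut (C0 \<Omega>)" "T (\<lambda>z. complex_of_real (p z)) = S (\<lambda>z. complex_of_real (p z))"
        using T p(1) unfolding ref_al_def by blast
      have "c x = T (\<lambda>z. complex_of_real (p z)) x" using Tc[OF p(1) x] p(2) by simp
      then have "c x \<in> insert 0 ((\<lambda>z. complex_of_real (p z)) ` \<Omega>)"
        using Aut_range[OF S(1) p(1)] S(2) x by auto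
      then obtain r :: real where "0 \<le> r" "c x = complex_of_real r"
        using p(3) by (force intro: less_imp_le)
      then show ?thesis using c(2)[OF x] by simp
    qed
    have "T (\<lambda>x. f x * g x) = (\<lambda>x. T f x * T g x)" if f: "f \<in> C0 \<Omega>" and g: "g \<in> C0 \<Omega>" for f g
      using f g by (intro C0_eqI[of _ \<Omega>] linear_ops_closed[OF lin] C0_mult) (simp_all add: Tc c1 C0_mult)
    then show "T \<in> Aut (C0 \<Omega>)"
      using lin Iso Iso_inj_on[OF Iso] by (auto simp: Aut_def Iso_def bij_betw_def)
  qed
  show "Aut (C0 \<Omega>) \<subseteq> ref_al (C0 \<Omega>) (supnorm \<Omega>) (Aut (C0 \<Omega>))"
    using Aut_subset_Iso Iso_subset_bounded_ops by (intro subset_ref_al) (rule order_trans)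
qed

theorem theorem4:
  fixes \<Omega> :: "(real ^ 'n) set"
  assumes "open \<Omega>" and "convex \<Omega>"
  shows "algebraically_reflexive (C0 \<Omega>) (supnorm \<Omega>) (Aut (C0 \<Omega>)) \<and>
         algebraically_reflexive (C0 \<Omega>) (supnorm \<Omega>) (Iso (C0 \<Omega>) (supnorm \<Omega>))"
  using assms(1) convex_connected[OF assms(2)]
  by (intro conjI Aut_C0_algebraically_reflexive Iso_C0_algebraically_reflexive)

end
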